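(* Let $\{\mathbf{A}_\lambda\}_{\lambda\in\Lambda}$ be a family of commutative BCK-algebras with $A_\lambda\cap A_\mu=\{0\}$ for $\lambda\ne\mu$, and let $\mathbf{U}$ be their cBCK-union. An ideal $P$ of $\mathbf{U}$ is prime if and only if there exist $\mu\in\Lambda$ and a prime ideal $Q$ of $\mathbf{A}_\mu$ such that $$P=Q\cup\bigcup_{\lambda\in\Lambda,\ \lambda\neq\mu}A_\lambda .$$
   Context: A commutative BCK-algebra is an algebra $\mathbf{A}=\langle A;\cdot,0\rangle$ of type $(2,0)$ such that for all $x,y,z\in A$: $(x\cdot y)\cdot z=(x\cdot z)\cdot y$; $x\cdot(x\cdot y)=y\cdot(y\cdot x)$; $x\cdot x=0$; $x\cdot 0=x$. Put $x\wedge y:=y\cdot(y\cdot x)$. An ideal is a subset $I\subseteq A$ with $0\in I$ such that $x\cdot y\in I$ and $y\in I$ imply $x\in I$. An ideal $P$ is prime if $P\neq A$ and $x\wedge y\in P$ implies $x\in P$ or $y\in P$. The cBCK-union of a family $\{\mathbf{A}_\lambda\}_{\lambda\in\Lambda}$ of commutative BCK-algebras with $A_\lambda\cap A_\mu=\{0\}$ for $\lambda\neq\mu$ is the commutative BCK-algebra $\mathbf{U}$ with universe $U=\bigcup_{\lambda\in\Lambda}A_\lambda$, the common element $0$ as constant, and operation $x\cdot y=x\cdot_\lambda y$ if $x,y\in A_\lambda$ for some $\lambda$ (where $\cdot_\lambda$ is the operation of $\mathbf{A}_\lambda$), and $x\cdot y=x$ otherwise. *)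

theory Defs
  imports Main
begin

text \<open>Algebras are given by an explicit carrier set, so that the members of a family
  can overlap inside one type and their union can be formed as a set.\<close>

locale commutative_bck_algebra =
  fixes A :: "'a set"
    and bck_mult :: "'a \<Rightarrow> 'a \<Rightarrow> 'a"  (infixl "\<cdot>" 70)
    and zero :: 'a  ("\<zero>")
  assumes mult_closed: "\<lbrakk>x \<in> A; y \<in> A\<rbrakk> \<Longrightarrow> x \<cdot> y \<in> A"
    and zero_closed: "\<zero> \<in> A"
    and mult_right_commute: "\<lbrakk>x \<in> A; y \<in> A; z \<in> A\<rbrakk> \<Longrightarrow> (x \<cdot> y) \<cdot> z = (x \<cdot> z) \<cdot> y"
    and meet_commute: "\<lbrakk>x \<in> A; y \<in> A\<rbrakk> \<Longrightarrow> x \<cdot> (x \<cdot> y) = y \<cdot> (y \<cdot> x)"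
    and mult_self: "x \<in> A \<Longrightarrow> x \<cdot> x = \<zero>"
    and mult_zero: "x \<in> A \<Longrightarrow> x \<cdot> \<zero> = x"

definition bck_meet :: "('a \<Rightarrow> 'a \<Rightarrow> 'a) \<Rightarrow> 'a \<Rightarrow> 'a \<Rightarrow> 'a" where
  "bck_meet m x y = m y (m y x)"

definition bck_ideal :: "'a set \<Rightarrow> ('a \<Rightarrow> 'a \<Rightarrow> 'a) \<Rightarrow> 'a \<Rightarrow> 'a set \<Rightarrow> bool" where
  "bck_ideal A m z I \<longleftrightarrow>
     I \<subseteq> A \<and> z \<in> I \<and> (\<forall>x\<in>A. \<forall>y\<in>A. m x y \<in> I \<and> y \<in> I \<longrightarrow> x \<in> I)"

definition bck_prime_ideal :: "'a set \<Rightarrow> ('a \<Rightarrow> 'a \<Rightarrow> 'a) \<Rightarrow> 'a \<Rightarrow> 'a set \<Rightarrow> bool" where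
  "bck_prime_ideal A m z P \<longleftrightarrow>
     bck_ideal A m z P \<and> P \<noteq> A \<and>
     (\<forall>x\<in>A. \<forall>y\<in>A. bck_meet m x y \<in> P \<longrightarrow> x \<in> P \<or> y \<in> P)"

definition cbck_union_carrier :: "'i set \<Rightarrow> ('i \<Rightarrow> 'a set) \<Rightarrow> 'a set" where
  "cbck_union_carrier \<Lambda> A = (\<Union>l\<in>\<Lambda>. A l)"

text \<open>The index \<open>l\<close> with \<open>x, y \<in> A l\<close> is unique unless \<open>x\<close> and \<open>y\<close> are both the
  common zero, and then every choice gives zero; so the chosen index does not matter
  (lemma \<open>cbck_union_mult_eq\<close>).\<close>

definition cbck_union_mult ::
  "'i set \<Rightarrow> ('i \<Rightarrow> 'a set) \<Rightarrow> ('i \<Rightarrow> 'a \<Rightarrow> 'a \<Rightarrow> 'a) \<Rightarrow> 'a \<Rightarrow> 'a \<Rightarrow> 'a" where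
  "cbck_union_mult \<Lambda> A m x y =
     (if \<exists>l\<in>\<Lambda>. x \<in> A l \<and> y \<in> A l
      then m (SOME l. l \<in> \<Lambda> \<and> x \<in> A l \<and> y \<in> A l) x y
      else x)"

locale cbck_family =
  fixes \<Lambda> :: "'i set"
    and A :: "'i \<Rightarrow> 'a set"
    and m :: "'i \<Rightarrow> 'a \<Rightarrow> 'a \<Rightarrow> 'a"
    and z :: 'a
  assumes algebra: "l \<in> \<Lambda> \<Longrightarrow> commutative_bck_algebra (A l) (m l) z"
    and inter: "\<lbrakk>k \<in> \<Lambda>; l \<in> \<Lambda>; k \<noteq> l\<rbrakk> \<Longrightarrow> A k \<inter> A l = {z}"
begin

lemma cbck_union_mult_eq:
  assumes "l \<in> \<Lambda>" "x \<in> A l" "y \<in> A l"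
  shows "cbck_union_mult \<Lambda> A m x y = m l x y"
proof -
  let ?k = "SOME k. k \<in> \<Lambda> \<and> x \<in> A k \<and> y \<in> A k"
  have k: "?k \<in> \<Lambda> \<and> x \<in> A ?k \<and> y \<in> A ?k"
    by (rule someI[of _ l]) (use assms in simp)
  have "m ?k x y = m l x y"
  proof (cases "?k = l")
    case False
    then have "x = z" "y = z" using inter[of ?k l] k assms by blast+
    then show ?thesis
      using commutative_bck_algebra.mult_self[OF algebra] k assms by metis
  qed simp
  then show ?thesis
    using assms by (auto simp: cbck_union_mult_def)
qed

lemma cbck_union_mult_neq:
  assumes "\<And>l. l \<in> \<Lambda> \<Longrightarrow> x \<in> A l \<Longrightarrow> y \<in> A l \<Longrightarrow> False"
  shows "cbck_union_mult \<Lambda> A m x y = x"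
  using assms by (auto simp: cbck_union_mult_def)

lemma zero_mult:
  assumes "l \<in> \<Lambda>" "x \<in> A l"
  shows "m l z x = z"
proof -
  interpret commutative_bck_algebra "A l" "m l" z by (rule algebra) fact
  have "m l z (m l z x) = m l x (m l x z)" using assms meet_commute zero_closed by blast
  then have 1: "m l z (m l z x) = z" using assms mult_zero mult_self by simp
  have "m l (m l z (m l z x)) x = m l (m l z x) (m l z x)"
    using assms mult_right_commute zero_closed mult_closed by blast
  then show ?thesis using 1 assms mult_self mult_closed zero_closed by simp
qed

lemma cbck_union_algebra:
  assumes "\<Lambda> \<noteq> {}"
  shows "commutative_bck_algebra (cbck_union_carrier \<Lambda> A) (cbck_union_mult \<Lambda> A m) z"
proof -
  let ?U = "cbck_union_carrier \<Lambda> A" and ?u = "cbck_union_mult \<Lambda> A m"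
  have memb: "\<And>x. x \<in> ?U \<longleftrightarrow> (\<exists>l\<in>\<Lambda>. x \<in> A l)" by (simp add: cbck_union_carrier_def)
  have zA: "\<And>l. l \<in> \<Lambda> \<Longrightarrow> z \<in> A l"
    using commutative_bck_algebra.zero_closed[OF algebra] .
  have cl: "\<And>l x y. \<lbrakk>l \<in> \<Lambda>; x \<in> A l; y \<in> A l\<rbrakk> \<Longrightarrow> m l x y \<in> A l"
    using commutative_bck_algebra.mult_closed[OF algebra] .
  have uz: "\<And>x. x \<in> ?U \<Longrightarrow> ?u z x = z"
    using memb zA cbck_union_mult_eq zero_mult by metis
  have ux: "\<And>x. x \<in> ?U \<Longrightarrow> ?u x x = z"
    using memb cbck_union_mult_eq commutative_bck_algebra.mult_self[OF algebra] by metis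
  have u0: "\<And>x. x \<in> ?U \<Longrightarrow> ?u x z = x"
    using memb zA cbck_union_mult_eq commutative_bck_algebra.mult_zero[OF algebra] by metis
  have in_l: "?u x y \<in> A l" if "l \<in> \<Lambda>" "x \<in> A l" "y \<in> ?U" for l x y
  proof (cases "\<exists>k\<in>\<Lambda>. x \<in> A k \<and> y \<in> A k")
    case True
    then obtain k where k: "k \<in> \<Lambda>" "x \<in> A k" "y \<in> A k" by blast
    show ?thesis
    proof (cases "k = l")
      case True then show ?thesis using k that cl cbck_union_mult_eq by metis
    next
      case False
      then have "x = z" using inter[of k l] k that by blast
      then show ?thesis using uz that zA by simp
    qed
  next
    case False then show ?thesis using that cbck_union_mult_neq[of x y] by auto
  qed
  have diff: "?u x y = x" if "l \<in> \<Lambda>" "x \<in> A l" "y \<in> ?U" "y \<notin> A l" for l x y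
  proof (cases "\<exists>k\<in>\<Lambda>. x \<in> A k \<and> y \<in> A k")
    case True
    then obtain k where k: "k \<in> \<Lambda>" "x \<in> A k" "y \<in> A k" by blast
    then have "k \<noteq> l" using that by blast
    then have "x = z" using inter[of k l] k that by blast
    then show ?thesis using uz that by simp
  next
    case False then show ?thesis using cbck_union_mult_neq[of x y] by auto
  qed
  show ?thesis
  proof
    fix x y assume xy: "x \<in> ?U" "y \<in> ?U"
    then show "?u x y \<in> ?U" using in_l memb by metis
    obtain l where l: "l \<in> \<Lambda>" "x \<in> A l" using xy memb by blast
    show "?u x (?u x y) = ?u y (?u y x)"
    proof (cases "y \<in> A l")
      case True
      then show ?thesis
        using l cl cbck_union_mult_eq commutative_bck_algebra.meet_commute[OF algebra[OF l(1)]]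
        by metis
    next
      case y: False
      obtain k where k: "k \<in> \<Lambda>" "y \<in> A k" using xy memb by blast
      have 1: "?u x (?u x y) = z" using diff[of l x y] l xy y ux by simp
      show ?thesis
      proof (cases "x \<in> A k")
        case True
        then have "x = z" using inter[of k l] k l y by blast
        then show ?thesis using 1 u0 ux xy by simp
      next
        case False
        then show ?thesis using 1 diff[of k y x] k xy ux by simp
      qed
    qed
  next
    show "z \<in> ?U" using assms zA memb by blast
  next
    fix x y w assume xyw: "x \<in> ?U" "y \<in> ?U" "w \<in> ?U"
    obtain l where l: "l \<in> \<Lambda>" "x \<in> A l" using xyw memb by blast
    note xy = in_l[OF l xyw(2)] and xw = in_l[OF l xyw(3)]
    show "?u (?u x y) w = ?u (?u x w) y"
    proof (cases "y \<in> A l \<and> w \<in> A l")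
      case True
      then show ?thesis
        using l cl cbck_union_mult_eq
          commutative_bck_algebra.mult_right_commute[OF algebra[OF l(1)]] by metis
    next
      case False
      then show ?thesis using diff[OF l(1)] l xy xw xyw by metis
    qed
  qed (use ux u0 in auto)
qed

end

end

theory Submission
  imports Defs
begin

text \<open>Elements of two different components have meet \<open>z\<close>, because subtracting either from the
  other changes nothing. Every ideal contains \<open>z\<close>, so a prime ideal that misses some \<open>x\<close> in one
  component must contain each component other than that one: it can be proper in one component
  only. Hence a prime ideal \<open>P\<close> of the union is determined by its trace on a single component
  \<open>A \<mu>\<close>, and since the operation of the union extends that of \<open>A \<mu>\<close>, the trace is a prime ideal
  there.

  Conversely, if \<open>P\<close> consists of a prime ideal \<open>Q\<close> of \<open>A \<mu>\<close> and all the other components, an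
  element outside \<open>P\<close> lies in \<open>A \<mu>\<close>. Primeness of \<open>P\<close> therefore only concerns pairs in \<open>A \<mu>\<close>,
  where the meets agree and \<open>P\<close> cuts out exactly \<open>Q\<close>.\<close>

context cbck_family
begin

lemma component_subset_carrier: "l \<in> \<Lambda> \<Longrightarrow> A l \<subseteq> cbck_union_carrier \<Lambda> A"
  by (auto simp: cbck_union_carrier_def)

lemma zero_in_component: "l \<in> \<Lambda> \<Longrightarrow> z \<in> A l"
  using commutative_bck_algebra.zero_closed[OF algebra] .

lemma union_meet_same_component:
  assumes "l \<in> \<Lambda>" "x \<in> A l" "y \<in> A l"
  shows "bck_meet (cbck_union_mult \<Lambda> A m) x y = bck_meet (m l) x y"
  using assms commutative_bck_algebra.mult_closed[OF algebra]
  by (simp add: bck_meet_def cbck_union_mult_eq)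

text \<open>If no component contains both elements, \<open>y \<cdot> (y \<cdot> x) = y \<cdot> y\<close>. A component containing
  both differs from one of the two given components, so one of the elements is the common zero
  and the meet is computed inside that component.\<close>

lemma union_meet_distinct_components:
  assumes "k \<in> \<Lambda>" "l \<in> \<Lambda>" "k \<noteq> l" "x \<in> A k" "y \<in> A l"
  shows "bck_meet (cbck_union_mult \<Lambda> A m) x y = z"
proof (cases "\<exists>j\<in>\<Lambda>. x \<in> A j \<and> y \<in> A j")
  case True
  then obtain j where j: "j \<in> \<Lambda>" "x \<in> A j" "y \<in> A j" by blast
  interpret commutative_bck_algebra "A j" "m j" z by (rule algebra) fact
  have "x = z \<or> y = z"
    using inter[of j k] inter[of j l] assms j by blast
  then have "bck_meet (m j) x y = z"
    using j zero_mult[OF j(1)] mult_zero mult_self zero_closed by (auto simp: bck_meet_def)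
  then show ?thesis using union_meet_same_component j by simp
next
  case False
  then have "cbck_union_mult \<Lambda> A m y x = y"
    using cbck_union_mult_neq[of y x] by blast
  then show ?thesis
    using cbck_union_mult_eq[of l y y] commutative_bck_algebra.mult_self[OF algebra] assms
    by (simp add: bck_meet_def)
qed

lemma ideal_trace_on_component:
  assumes "bck_ideal (cbck_union_carrier \<Lambda> A) (cbck_union_mult \<Lambda> A m) z P" "l \<in> \<Lambda>"
  shows "bck_ideal (A l) (m l) z (P \<inter> A l)"
  using assms component_subset_carrier[of l] zero_in_component[of l] cbck_union_mult_eq[of l]
  unfolding bck_ideal_def by (metis IntD1 IntI inf_le2 subsetD)

text \<open>The trace on a component inherits primeness once it is proper, because meets within the
  component are the same in both algebras.\<close>

lemma prime_ideal_trace_on_component: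
  assumes P: "bck_prime_ideal (cbck_union_carrier \<Lambda> A) (cbck_union_mult \<Lambda> A m) z P"
    and l: "l \<in> \<Lambda>" and proper: "\<not> A l \<subseteq> P"
  shows "bck_prime_ideal (A l) (m l) z (P \<inter> A l)"
  unfolding bck_prime_ideal_def
proof (intro conjI ballI impI)
  show "bck_ideal (A l) (m l) z (P \<inter> A l)"
    using P l ideal_trace_on_component by (simp add: bck_prime_ideal_def)
  show "P \<inter> A l \<noteq> A l" using proper by blast
  fix x y assume xy: "x \<in> A l" "y \<in> A l" "bck_meet (m l) x y \<in> P \<inter> A l"
  then have "bck_meet (cbck_union_mult \<Lambda> A m) x y \<in> P"
    using l union_meet_same_component by simp
  then show "x \<in> P \<inter> A l \<or> y \<in> P \<inter> A l"
    using P xy component_subset_carrier[OF l] unfolding bck_prime_ideal_def by blast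
qed

lemma prime_ideal_contains_other_components:
  assumes P: "bck_prime_ideal (cbck_union_carrier \<Lambda> A) (cbck_union_mult \<Lambda> A m) z P"
    and k: "k \<in> \<Lambda>" "\<not> A k \<subseteq> P" and l: "l \<in> \<Lambda>" "k \<noteq> l"
  shows "A l \<subseteq> P"
proof
  fix y assume y: "y \<in> A l"
  obtain x where x: "x \<in> A k" "x \<notin> P" using k by blast
  have "bck_meet (cbck_union_mult \<Lambda> A m) x y \<in> P"
    using union_meet_distinct_components[OF k(1) l x(1) y] P
    by (simp add: bck_prime_ideal_def bck_ideal_def)
  then show "y \<in> P"
    using P x y component_subset_carrier[OF k(1)] component_subset_carrier[OF l(1)]
    unfolding bck_prime_ideal_def by blast
qed

lemma prime_ideal_of_union_decompose:
  assumes P: "bck_prime_ideal (cbck_union_carrier \<Lambda> A) (cbck_union_mult \<Lambda> A m) z P"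
  shows "\<exists>\<mu>\<in>\<Lambda>. \<exists>Q. bck_prime_ideal (A \<mu>) (m \<mu>) z Q \<and> P = Q \<union> (\<Union>l\<in>\<Lambda> - {\<mu>}. A l)"
proof -
  have sub: "P \<subseteq> (\<Union>l\<in>\<Lambda>. A l)" and ne: "P \<noteq> (\<Union>l\<in>\<Lambda>. A l)"
    using P by (auto simp: bck_prime_ideal_def bck_ideal_def cbck_union_carrier_def)
  then obtain \<mu> where \<mu>: "\<mu> \<in> \<Lambda>" "\<not> A \<mu> \<subseteq> P" by blast
  have "(\<Union>l\<in>\<Lambda> - {\<mu>}. A l) \<subseteq> P"
    using prime_ideal_contains_other_components[OF P \<mu>] by blast
  with sub have "P = (P \<inter> A \<mu>) \<union> (\<Union>l\<in>\<Lambda> - {\<mu>}. A l)" by blast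
  then show ?thesis
    using \<mu> prime_ideal_trace_on_component[OF P \<mu>] by blast
qed

lemma prime_ideal_of_union_compose:
  assumes P: "bck_ideal (cbck_union_carrier \<Lambda> A) (cbck_union_mult \<Lambda> A m) z P"
    and \<mu>: "\<mu> \<in> \<Lambda>" and Q: "bck_prime_ideal (A \<mu>) (m \<mu>) z Q"
    and eq: "P = Q \<union> (\<Union>l\<in>\<Lambda> - {\<mu>}. A l)"
  shows "bck_prime_ideal (cbck_union_carrier \<Lambda> A) (cbck_union_mult \<Lambda> A m) z P"
proof -
  have Q': "Q \<subseteq> A \<mu>" "z \<in> Q" "Q \<noteq> A \<mu>"
    using Q by (auto simp: bck_prime_ideal_def bck_ideal_def)
  \<comment> \<open>The other components add at most \<open>z\<close> to the trace, and \<open>z\<close> is already in \<open>Q\<close>.\<close>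
  have "A l \<inter> A \<mu> \<subseteq> Q" if "l \<in> \<Lambda> - {\<mu>}" for l
    using inter[of l \<mu>] that \<mu> Q' by auto
  then have trace: "P \<inter> A \<mu> = Q" using eq Q' by blast
  have outside: "x \<in> A \<mu>" if "x \<in> cbck_union_carrier \<Lambda> A" "x \<notin> P" for x
    using that eq by (auto simp: cbck_union_carrier_def)
  show ?thesis
    unfolding bck_prime_ideal_def
  proof (intro conjI ballI impI)
    show "P \<noteq> cbck_union_carrier \<Lambda> A"
      using component_subset_carrier[OF \<mu>] trace Q' by blast
    fix x y
    assume xy: "x \<in> cbck_union_carrier \<Lambda> A" "y \<in> cbck_union_carrier \<Lambda> A"
      and meet: "bck_meet (cbck_union_mult \<Lambda> A m) x y \<in> P"
    show "x \<in> P \<or> y \<in> P"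
    proof (rule ccontr)
      assume out: "\<not> (x \<in> P \<or> y \<in> P)"
      then have x: "x \<in> A \<mu>" and y: "y \<in> A \<mu>" using outside xy by auto
      interpret commutative_bck_algebra "A \<mu>" "m \<mu>" z by (rule algebra) fact
      have "bck_meet (m \<mu>) x y \<in> A \<mu>"
        using x y mult_closed by (simp add: bck_meet_def)
      then have "bck_meet (m \<mu>) x y \<in> Q"
        using meet trace union_meet_same_component[OF \<mu> x y] by auto
      then show False
        using Q x y out trace unfolding bck_prime_ideal_def by blast
    qed
  qed (rule P)
qed

end

theorem theorem3p2:
  fixes \<Lambda> :: "'i set"
    and A :: "'i \<Rightarrow> 'a set"
    and m :: "'i \<Rightarrow> 'a \<Rightarrow> 'a \<Rightarrow> 'a"
    and z :: 'a
    and P :: "'a set"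
  assumes "\<And>l. l \<in> \<Lambda> \<Longrightarrow> commutative_bck_algebra (A l) (m l) z"
    and "\<And>k l. \<lbrakk>k \<in> \<Lambda>; l \<in> \<Lambda>; k \<noteq> l\<rbrakk> \<Longrightarrow> A k \<inter> A l = {z}"
    and "bck_ideal (cbck_union_carrier \<Lambda> A) (cbck_union_mult \<Lambda> A m) z P"
  shows "bck_prime_ideal (cbck_union_carrier \<Lambda> A) (cbck_union_mult \<Lambda> A m) z P \<longleftrightarrow>
    (\<exists>\<mu>\<in>\<Lambda>. \<exists>Q. bck_prime_ideal (A \<mu>) (m \<mu>) z Q \<and> P = Q \<union> (\<Union>l\<in>\<Lambda> - {\<mu>}. A l))"
proof -
  interpret cbck_family \<Lambda> A m z
    by (rule cbck_family.intro) (fact assms(1,2))+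
  show ?thesis
    using prime_ideal_of_union_decompose prime_ideal_of_union_compose[OF assms(3)] by blast
qed

end
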